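(* We have $$\bigcap_{b\in B}P_{\mathrm{SCF}}(b)=\bigcap_{b\in V_{\mathrm{SCF}}}P_{\mathrm{SCF}}(b)=\overline P_{\mathrm{SCF}},$$ where $$\overline P_{\mathrm{SCF}}=\Big\{x\in P_{\mathrm{AP}} : \sum_{ij\in\delta^+(S)}x_{ij}\geq 1\ \text{ for all } S\in\mathcal S_1\Big\}.$$
   Context: Let $n\ge 4$, $N=\{1,\dots,n\}$, $A=\{ij : i,j\in N,\ i\ne j\}$, $N_1=N\setminus\{1\}$. $\mathcal S_1$ is the set of subsets of $N_1$ of size at least 2. For $S\subseteq N$, $\delta^+(S)=\{ij\in A : i\in S,\ j\notin S\}$ and $\delta^-(S)=\{ij\in A : i\notin S,\ j\in S\}$, with $\delta^\pm(i)=\delta^\pm(\{i\})$. $P_{\mathrm{AP}}$ is the set of $x\in[0,1]^A$ with $\sum_{j\neq i}x_{ij}=1$ and $\sum_{j\ne i}x_{ji}=1$ for all $i\in N$. $B=\{b\in\mathbb R_{++}^{N_1} : \sum_{i\in N_1}b_i=1\}$, where $\mathbb R_{++}$ denotes the positive reals, and $\overline B$ is the same set with $\mathbb R_{++}$ replaced by the nonnegative reals $\mathbb R_+$. For $b\in\overline B$, $P_{\mathrm{SCF}}(b)$ is the projection onto the $x$ variables of the set $Q_{\mathrm{SCF}}(b)$ of $(x,f)\in P_{\mathrm{AP}}\times\mathbb R^A_+$ with $$\sum_{ij\in\delta^+(i)}f_{ij}-\sum_{ji\in\delta^-(i)}f_{ji}=-b_i\ \text{ for all } i\in N_1,\qquad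 f_{ij}\le x_{ij}\ \text{ for all } ij\in A.$$ For $k\in N_1$, $b^k\in\overline B$ is the $k$-th canonical (unit) vector of $\mathbb R^{N_1}$; $V_{\mathrm{SCF}}=\{b^k : k\in N_1\}$. (The paper writes $\mathbf{Cl}(P_{\mathrm{SCF}}(B'))$ for $\bigcap_{b\in B'}P_{\mathrm{SCF}}(b)$.) *)

theory Defs
  imports Complex_Main "HOL-Library.FuncSet"
begin

text \<open>
  A vector indexed by a finite set \<open>I\<close> is an extensional function, i.e. an element
  of \<open>I \<rightarrow>\<^sub>E T\<close>; thus equality of vectors is equality of their entries on \<open>I\<close>.
\<close>

definition nodes :: "nat \<Rightarrow> nat set" where
  "nodes n = {1..n}"

definition arcs :: "nat \<Rightarrow> (nat \<times> nat) set" where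
  "arcs n = {(i, j). i \<in> nodes n \<and> j \<in> nodes n \<and> i \<noteq> j}"

definition nodes1 :: "nat \<Rightarrow> nat set" where
  "nodes1 n = nodes n - {1}"

definition S1 :: "nat \<Rightarrow> nat set set" where
  "S1 n = {S. S \<subseteq> nodes1 n \<and> card S \<ge> 2}"

definition out_arcs :: "nat \<Rightarrow> nat set \<Rightarrow> (nat \<times> nat) set" where
  "out_arcs n S = {(i, j) \<in> arcs n. i \<in> S \<and> j \<notin> S}"

definition in_arcs :: "nat \<Rightarrow> nat set \<Rightarrow> (nat \<times> nat) set" where
  "in_arcs n S = {(i, j) \<in> arcs n. i \<notin> S \<and> j \<in> S}"

definition P_AP :: "nat \<Rightarrow> (nat \<times> nat \<Rightarrow> real) set" where
  "P_AP n = {x \<in> arcs n \<rightarrow>\<^sub>E {0..1}.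
     \<forall>i\<in>nodes n. (\<Sum>j\<in>nodes n - {i}. x (i, j)) = 1 \<and> (\<Sum>j\<in>nodes n - {i}. x (j, i)) = 1}"

definition B :: "nat \<Rightarrow> (nat \<Rightarrow> real) set" where
  "B n = {b \<in> nodes1 n \<rightarrow>\<^sub>E {0<..}. (\<Sum>i\<in>nodes1 n. b i) = 1}"

definition Q_SCF :: "nat \<Rightarrow> (nat \<Rightarrow> real) \<Rightarrow> ((nat \<times> nat \<Rightarrow> real) \<times> (nat \<times> nat \<Rightarrow> real)) set" where
  "Q_SCF n b = {(x, f) \<in> P_AP n \<times> (arcs n \<rightarrow>\<^sub>E {0..}).
     (\<forall>i\<in>nodes1 n. (\<Sum>a\<in>out_arcs n {i}. f a) - (\<Sum>a\<in>in_arcs n {i}. f a) = - b i) \<and>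
     (\<forall>a\<in>arcs n. f a \<le> x a)}"

definition P_SCF :: "nat \<Rightarrow> (nat \<Rightarrow> real) \<Rightarrow> (nat \<times> nat \<Rightarrow> real) set" where
  "P_SCF n b = fst ` Q_SCF n b"

definition unit_vec :: "nat \<Rightarrow> nat \<Rightarrow> nat \<Rightarrow> real" where
  "unit_vec n k = restrict (\<lambda>i. if i = k then 1 else 0) (nodes1 n)"

definition V_SCF :: "nat \<Rightarrow> (nat \<Rightarrow> real) set" where
  "V_SCF n = {unit_vec n k | k. k \<in> nodes1 n}"

definition P_SCF_bar :: "nat \<Rightarrow> (nat \<times> nat \<Rightarrow> real) set" where
  "P_SCF_bar n = {x \<in> P_AP n. \<forall>S\<in>S1 n. (\<Sum>a\<in>out_arcs n S. x a) \<ge> 1}"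

end

theory Submission
  imports Defs
begin

text \<open>
  The three sets are shown equal by a cycle of inclusions.

  If \<open>x\<close> carries, for every single sink \<open>k\<close>, a unit flow from node \<open>1\<close> to \<open>k\<close>, then the
  convex combination of these flows with weights \<open>b k\<close> obeys the same capacities and delivers
  \<open>b k\<close> to each \<open>k\<close>; hence feasibility for all of \<open>V_SCF\<close> implies feasibility for all of \<open>B\<close>.

  If \<open>x\<close> carries a flow for every positive demand \<open>b\<close>, then the capacity entering a set \<open>S\<close>
  is at least the demand inside \<open>S\<close>, and this demand comes arbitrarily close to \<open>1\<close> when \<open>b\<close>
  concentrates on one element of \<open>S\<close>. Every point of the assignment polytope is balanced at
  each node, so as much of it leaves \<open>S\<close> as enters it, and the cut inequality for \<open>S\<close> follows.

  Finally, if all cut inequalities hold, every cut separating \<open>1\<close> from \<open>k\<close> has capacity at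
  least \<open>1\<close> (the cuts around singletons do so by the assignment equations), and a unit
  flow to \<open>k\<close> exists by the max-flow min-cut principle. The latter is used in the form of Gale's
  feasibility theorem: supplies \<open>d\<close> that sum to zero can be routed as soon as no set of nodes has
  a larger supply than the capacity of its outgoing arcs. It is proved by induction on the arcs, so
  that neither augmenting paths nor the existence of a maximum flow enter.
\<close>

section \<open>Feasible flows with prescribed supplies\<close>

definition cut_capacity :: "('a \<times> 'a) set \<Rightarrow> ('a \<times> 'a \<Rightarrow> real) \<Rightarrow> 'a set \<Rightarrow> real" where
  "cut_capacity E c S = (\<Sum>e\<in>E. c e * of_bool (fst e \<in> S \<and> snd e \<notin> S))"

text \<open>
  An arc between \<open>S - T\<close> and \<open>T - S\<close> counts on the right only; every other arc counts equally
  often on both sides.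
\<close>

lemma cut_capacity_submodular:
  assumes "\<And>e. e \<in> E \<Longrightarrow> 0 \<le> c e"
  shows "cut_capacity E c (S \<inter> T) + cut_capacity E c (S \<union> T)
    \<le> cut_capacity E c S + cut_capacity E c T"
  unfolding cut_capacity_def sum.distrib[symmetric] ring_distribs(1)[symmetric]
  by (intro sum_mono mult_left_mono assms) auto

text \<open>
  Fix the flow \<open>t\<close> on one arc \<open>(u, v)\<close>, delete the arc and shift \<open>t\<close> units of supply from \<open>u\<close> to
  \<open>v\<close>. The cut condition then survives for sets containing \<open>u\<close> but not \<open>v\<close> if \<open>t\<close> is large enough,
  and for sets containing \<open>v\<close> but not \<open>u\<close> if \<open>t\<close> is small enough. Submodularity makes the lower
  and the upper bounds on \<open>t\<close> compatible, so induction applies to the remaining arcs.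
\<close>

theorem flow_with_supplies_exists:
  fixes d :: "'a \<Rightarrow> real"
  assumes "finite E" and "finite V" and "E \<subseteq> V \<times> V"
    and "\<And>e. e \<in> E \<Longrightarrow> 0 \<le> c e"
    and "sum d V = 0"
    and "\<And>S. S \<subseteq> V \<Longrightarrow> sum d S \<le> cut_capacity E c S"
  shows "\<exists>f. (\<forall>e\<in>E. 0 \<le> f e \<and> f e \<le> c e) \<and>
    (\<forall>w\<in>V. (\<Sum>e\<in>E. f e * (of_bool (fst e = w) - of_bool (snd e = w))) = d w)"
  using assms(1,3-)
proof (induction E arbitrary: d rule: finite_induct)
  case empty
  have "d w = 0" if "w \<in> V" for w
  proof -
    have "d w \<le> 0"
      using empty.prems(4)[of "{w}"] that by (simp add: cut_capacity_def)
    moreover have "sum d (V - {w}) \<le> 0"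
      using empty.prems(4)[of "V - {w}"] by (auto simp: cut_capacity_def)
    moreover have "sum d V = d w + sum d (V - {w})"
      using that \<open>finite V\<close> by (simp add: sum.remove)
    ultimately show ?thesis using empty.prems(3) by linarith
  qed
  then show ?case by simp
next
  case (insert a E)
  obtain u v where a: "a = (u, v)" by fastforce
  have uv: "u \<in> V" "v \<in> V" using insert.prems(1) a by auto
  have c_nonneg: "0 \<le> c e" if "e \<in> E" for e using insert.prems(2) that by simp
  have ca: "0 \<le> c a" using insert.prems(2) by simp
  have cut_insert: "cut_capacity (insert a E) c S
      = c a * of_bool (u \<in> S \<and> v \<notin> S) + cut_capacity E c S" for S
    using insert.hyps a by (simp add: cut_capacity_def)
  define L where "L = insert 0 ((\<lambda>S. sum d S - cut_capacity E c S) ` {S \<in> Pow V. u \<in> S \<and> v \<notin> S})"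
  define t where "t = Max L"
  have finL: "finite L" using \<open>finite V\<close> by (simp add: L_def)
  have t_nonneg: "0 \<le> t" unfolding t_def using finL by (intro Max_ge) (auto simp: L_def)
  have t_lower: "sum d S - cut_capacity E c S \<le> t" if "S \<subseteq> V" "u \<in> S" "v \<notin> S" for S
    unfolding t_def using finL that by (intro Max_ge) (auto simp: L_def)
  have "t \<in> L" unfolding t_def using finL by (intro Max_in) (auto simp: L_def)
  have t_le_c: "t \<le> c a"
    using \<open>t \<in> L\<close> unfolding L_def
  proof (elim insertE imageE)
    fix S assume "t = sum d S - cut_capacity E c S" and S: "S \<in> {S \<in> Pow V. u \<in> S \<and> v \<notin> S}"
    then show ?thesis using insert.prems(4)[of S] cut_insert[of S] by auto
  qed (use ca in simp)
  have t_upper: "sum d T + t \<le> cut_capacity E c T" if T: "T \<subseteq> V" "v \<in> T" "u \<notin> T" for T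
    using \<open>t \<in> L\<close> unfolding L_def
  proof (elim insertE imageE)
    assume "t = 0"
    then show ?thesis using insert.prems(4)[OF T(1)] T cut_insert[of T] by simp
  next
    fix S assume t: "t = sum d S - cut_capacity E c S" and S: "S \<in> {S \<in> Pow V. u \<in> S \<and> v \<notin> S}"
    have "finite S" "finite T" using S T \<open>finite V\<close> finite_subset by auto
    then have "sum d S + sum d T = sum d (S \<inter> T) + sum d (S \<union> T)"
      using sum.union_inter[of S T d] by simp
    moreover have "sum d (S \<inter> T) \<le> cut_capacity E c (S \<inter> T)"
      using insert.prems(4)[of "S \<inter> T"] S T cut_insert[of "S \<inter> T"] by auto
    moreover have "sum d (S \<union> T) \<le> cut_capacity E c (S \<union> T)"
      using insert.prems(4)[of "S \<union> T"] S T cut_insert[of "S \<union> T"] by auto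
    ultimately show ?thesis
      using cut_capacity_submodular[of E c S T, OF c_nonneg] t by linarith
  qed
  define d' where "d' w = d w - t * (of_bool (u = w) - of_bool (v = w))" for w
  have sum_d': "sum d' S = sum d S - t * (of_bool (u \<in> S) - of_bool (v \<in> S))" if "S \<subseteq> V" for S
  proof -
    have "finite S" using that \<open>finite V\<close> finite_subset by blast
    then show ?thesis
      by (simp add: d'_def sum_subtractf sum_distrib_left[symmetric] of_bool_def)
  qed
  have "\<exists>f. (\<forall>e\<in>E. 0 \<le> f e \<and> f e \<le> c e) \<and>
    (\<forall>w\<in>V. (\<Sum>e\<in>E. f e * (of_bool (fst e = w) - of_bool (snd e = w))) = d' w)"
  proof (rule insert.IH)
    show "E \<subseteq> V \<times> V" using insert.prems(1) by simp
    show "sum d' V = 0" using sum_d'[of V] uv insert.prems(3) by simp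
    show "sum d' S \<le> cut_capacity E c S" if "S \<subseteq> V" for S
      using sum_d'[OF that] t_lower[OF that] t_upper[OF that] insert.prems(4)[OF that]
        cut_insert[of S]
      by (cases "u \<in> S"; cases "v \<in> S") auto
  qed (use c_nonneg in auto)
  then obtain f where f: "\<And>e. e \<in> E \<Longrightarrow> 0 \<le> f e \<and> f e \<le> c e"
    and fd: "\<And>w. w \<in> V \<Longrightarrow> (\<Sum>e\<in>E. f e * (of_bool (fst e = w) - of_bool (snd e = w))) = d' w"
    by blast
  let ?g = "f(a := t)"
  have "(\<Sum>e\<in>insert a E. ?g e * (of_bool (fst e = w) - of_bool (snd e = w))) = d w"
    if "w \<in> V" for w
  proof -
    have "(\<Sum>e\<in>E. ?g e * (of_bool (fst e = w) - of_bool (snd e = w))) = d' w"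
      unfolding fd[OF that, symmetric] using insert.hyps(2) by (intro sum.cong) auto
    then show ?thesis using insert.hyps by (simp add: a d'_def)
  qed
  moreover have "\<forall>e\<in>insert a E. 0 \<le> ?g e \<and> ?g e \<le> c e"
    using f t_nonneg t_le_c by auto
  ultimately show ?case by blast
qed

section \<open>Net outflow of a set of nodes\<close>

lemma finite_nodes [simp]: "finite (nodes n)" "finite (nodes1 n)"
  by (auto simp: nodes_def nodes1_def)

lemma arcs_subset: "arcs n \<subseteq> nodes n \<times> nodes n"
  by (auto simp: arcs_def)

lemma finite_arcs [simp]: "finite (arcs n)"
  by (rule finite_subset[OF arcs_subset]) simp

definition net_outflow :: "nat \<Rightarrow> (nat \<times> nat \<Rightarrow> real) \<Rightarrow> nat set \<Rightarrow> real" where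
  "net_outflow n g S = sum g (out_arcs n S) - sum g (in_arcs n S)"

lemma sum_out_arcs: "sum g (out_arcs n S) = cut_capacity (arcs n) g S"
proof -
  have "out_arcs n S = arcs n \<inter> {a. fst a \<in> S \<and> snd a \<notin> S}"
    by (auto simp: out_arcs_def)
  then show ?thesis by (simp add: cut_capacity_def)
qed

lemma in_arcs_eq_out_arcs: "in_arcs n S = out_arcs n (nodes n - S)"
  by (auto simp: in_arcs_def out_arcs_def arcs_def)

lemma net_outflow_eq_sum_arcs:
  "net_outflow n g S = (\<Sum>a\<in>arcs n. g a * (of_bool (fst a \<in> S) - of_bool (snd a \<in> S)))"
  unfolding net_outflow_def in_arcs_eq_out_arcs sum_out_arcs cut_capacity_def
    sum_subtractf[symmetric] right_diff_distrib[symmetric]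
  by (intro sum.cong) (auto simp: arcs_def)

lemma net_outflow_eq_sum_nodes:
  assumes "finite S"
  shows "net_outflow n g S = (\<Sum>i\<in>S. net_outflow n g {i})"
  unfolding net_outflow_eq_sum_arcs
  by (subst sum.swap)
    (simp add: sum_distrib_left[symmetric] sum_subtractf of_bool_def assms)

lemma net_outflow_sum:
  "net_outflow n (\<lambda>a. \<Sum>k\<in>K. w k * f k a) S = (\<Sum>k\<in>K. w k * net_outflow n (f k) S)"
  unfolding net_outflow_eq_sum_arcs
  by (simp add: sum_distrib_left sum_distrib_right mult.assoc) (rule sum.swap)

section \<open>The assignment polytope\<close>

lemma P_AP_nonneg:
  assumes "x \<in> P_AP n" "a \<in> arcs n"
  shows "0 \<le> x a"
  using assms by (force simp: P_AP_def PiE_iff)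

lemma P_AP_degree:
  assumes "x \<in> P_AP n" "i \<in> nodes n"
  shows "sum x (out_arcs n {i}) = 1" "sum x (in_arcs n {i}) = 1"
proof -
  have "out_arcs n {i} = Pair i ` (nodes n - {i})"
    using assms(2) by (auto simp: out_arcs_def arcs_def)
  then show "sum x (out_arcs n {i}) = 1"
    using assms by (simp add: sum.reindex inj_on_def P_AP_def)
  have "in_arcs n {i} = (\<lambda>j. (j, i)) ` (nodes n - {i})"
    using assms(2) by (auto simp: in_arcs_def arcs_def)
  then show "sum x (in_arcs n {i}) = 1"
    using assms by (simp add: sum.reindex inj_on_def P_AP_def)
qed

lemma P_AP_balanced:
  assumes "x \<in> P_AP n" "S \<subseteq> nodes n"
  shows "sum x (out_arcs n S) = sum x (in_arcs n S)"
proof -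
  have "finite S" using assms(2) by (rule finite_subset) simp
  then have "net_outflow n x S = (\<Sum>i\<in>S. net_outflow n x {i})"
    by (rule net_outflow_eq_sum_nodes)
  also have "\<dots> = 0"
    using assms P_AP_degree by (intro sum.neutral) (auto simp: net_outflow_def)
  finally show ?thesis by (simp add: net_outflow_def)
qed

lemma P_SCF_iff:
  "x \<in> P_SCF n b \<longleftrightarrow> x \<in> P_AP n \<and>
    (\<exists>f. (\<forall>a\<in>arcs n. 0 \<le> f a \<and> f a \<le> x a) \<and> (\<forall>i\<in>nodes1 n. net_outflow n f {i} = - b i))"
proof (intro iffI conjI)
  assume "x \<in> P_SCF n b"
  then obtain f where "(x, f) \<in> Q_SCF n b" by (auto simp: P_SCF_def)
  then show "x \<in> P_AP n"
    and "\<exists>f. (\<forall>a\<in>arcs n. 0 \<le> f a \<and> f a \<le> x a) \<and> (\<forall>i\<in>nodes1 n. net_outflow n f {i} = - b i)"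
    by (auto simp: Q_SCF_def net_outflow_def intro!: exI[of _ f])
next
  assume "x \<in> P_AP n \<and>
    (\<exists>f. (\<forall>a\<in>arcs n. 0 \<le> f a \<and> f a \<le> x a) \<and> (\<forall>i\<in>nodes1 n. net_outflow n f {i} = - b i))"
  then obtain f where x: "x \<in> P_AP n" and f: "\<And>a. a \<in> arcs n \<Longrightarrow> 0 \<le> f a \<and> f a \<le> x a"
    and net: "\<And>i. i \<in> nodes1 n \<Longrightarrow> net_outflow n f {i} = - b i" by blast
  let ?f = "restrict f (arcs n)"
  have "net_outflow n ?f {i} = net_outflow n f {i}" for i
    by (simp add: net_outflow_eq_sum_arcs)
  then have "(x, ?f) \<in> Q_SCF n b"
    using x f net by (auto simp: Q_SCF_def net_outflow_def)
  then show "x \<in> P_SCF n b" by (force simp: P_SCF_def)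
qed

section \<open>The cycle of inclusions\<close>

lemma P_SCF_if_P_SCF_unit_vec:
  assumes b: "b \<in> B n" and x: "\<And>k. k \<in> nodes1 n \<Longrightarrow> x \<in> P_SCF n (unit_vec n k)"
  shows "x \<in> P_SCF n b"
proof -
  have b_pos: "0 < b k" if "k \<in> nodes1 n" for k using b that by (auto simp: B_def PiE_iff)
  have b_sum: "sum b (nodes1 n) = 1" using b by (simp add: B_def)
  then have "nodes1 n \<noteq> {}" by auto
  then have "x \<in> P_AP n" using x by (auto simp: P_SCF_iff)
  have "\<forall>k\<in>nodes1 n. \<exists>f. (\<forall>a\<in>arcs n. 0 \<le> f a \<and> f a \<le> x a) \<and>
      (\<forall>i\<in>nodes1 n. net_outflow n f {i} = - unit_vec n k i)"
    using x by (simp add: P_SCF_iff)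
  then obtain f where f: "\<And>k a. k \<in> nodes1 n \<Longrightarrow> a \<in> arcs n \<Longrightarrow> 0 \<le> f k a \<and> f k a \<le> x a"
    and net: "\<And>k i. k \<in> nodes1 n \<Longrightarrow> i \<in> nodes1 n \<Longrightarrow> net_outflow n (f k) {i} = - unit_vec n k i"
    by (auto dest!: bchoice)
  let ?f = "\<lambda>a. \<Sum>k\<in>nodes1 n. b k * f k a"
  have "0 \<le> ?f a \<and> ?f a \<le> x a" if "a \<in> arcs n" for a
  proof
    show "0 \<le> ?f a" using f b_pos that by (intro sum_nonneg mult_nonneg_nonneg) (auto intro: less_imp_le)
    have "?f a \<le> (\<Sum>k\<in>nodes1 n. b k * x a)"
      using f b_pos that by (intro sum_mono mult_left_mono) (auto intro: less_imp_le)
    then show "?f a \<le> x a" using b_sum by (simp add: sum_distrib_right[symmetric])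
  qed
  moreover have "net_outflow n ?f {i} = - b i" if "i \<in> nodes1 n" for i
  proof -
    have "net_outflow n ?f {i} = (\<Sum>k\<in>nodes1 n. b k * - unit_vec n k i)"
      unfolding net_outflow_sum using net that by (intro sum.cong) auto
    also have "\<dots> = (\<Sum>k\<in>nodes1 n. if i = k then - b k else 0)"
      using that by (intro sum.cong) (auto simp: unit_vec_def)
    finally show ?thesis using that by simp
  qed
  ultimately show ?thesis
    unfolding P_SCF_iff using \<open>x \<in> P_AP n\<close> by (intro conjI exI[of _ ?f] ballI) auto
qed

text \<open>
  Whatever is demanded inside \<open>S\<close> has to enter \<open>S\<close>, and by balance the capacity that enters
  \<open>S\<close> equals the capacity that leaves it.
\<close>

lemma demand_le_cut:
  assumes "x \<in> P_SCF n b" and "S \<subseteq> nodes1 n"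
  shows "sum b S \<le> sum x (out_arcs n S)"
proof -
  have S: "S \<subseteq> nodes n" "finite S"
    using assms(2) finite_subset[OF assms(2)] by (auto simp: nodes1_def)
  obtain f where x: "x \<in> P_AP n" and f: "\<And>a. a \<in> arcs n \<Longrightarrow> 0 \<le> f a \<and> f a \<le> x a"
    and net: "\<And>i. i \<in> nodes1 n \<Longrightarrow> net_outflow n f {i} = - b i"
    using assms(1) unfolding P_SCF_iff by blast
  have "net_outflow n f S = (\<Sum>i\<in>S. - b i)"
    unfolding net_outflow_eq_sum_nodes[OF S(2)] using net assms(2) by (intro sum.cong) auto
  then have "sum b S = sum f (in_arcs n S) - sum f (out_arcs n S)"
    by (simp add: net_outflow_def sum_negf)
  also have "\<dots> \<le> sum f (in_arcs n S)"
    using f by (auto intro!: sum_nonneg simp: out_arcs_def)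
  also have "\<dots> \<le> sum x (in_arcs n S)"
    using f by (intro sum_mono) (auto simp: in_arcs_def)
  also have "\<dots> = sum x (out_arcs n S)" using P_AP_balanced[OF x S(1)] by simp
  finally show ?thesis .
qed

lemma P_SCF_bar_if_P_SCF_B:
  assumes ne: "nodes1 n \<noteq> {}" and x: "\<And>b. b \<in> B n \<Longrightarrow> x \<in> P_SCF n b"
  shows "x \<in> P_SCF_bar n"
proof -
  define m where "m = real (card (nodes1 n))"
  have m: "0 < m" using ne by (simp add: m_def card_gt_0_iff)
  \<comment> \<open>a positive demand that puts all but at most \<open>e\<close> of its weight on \<open>s\<close>\<close>
  define b where "b s e = restrict (\<lambda>i. e / m + (1 - e) * of_bool (i = s)) (nodes1 n)"
    for s :: nat and e :: real
  have b: "b s e \<in> B n" if "s \<in> nodes1 n" "0 < e" "e < 1" for s e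
    using that m
    by (auto simp: B_def b_def sum.distrib of_bool_def m_def[symmetric]
        sum_distrib_left[symmetric] intro!: add_pos_nonneg)
  have "1 \<le> sum x (out_arcs n S)" if "S \<in> S1 n" for S
  proof (rule field_le_epsilon)
    fix e' :: real assume "0 < e'"
    define e where "e = min e' (1/2)"
    have e: "0 < e" "e < 1" "e \<le> e'" using \<open>0 < e'\<close> by (auto simp: e_def)
    have S: "S \<subseteq> nodes1 n" "S \<noteq> {}" using that by (auto simp: S1_def)
    then obtain s where s: "s \<in> S" "s \<in> nodes1 n" by blast
    have "1 - e \<le> b s e s" using s m e by (simp add: b_def)
    also have "\<dots> \<le> sum (b s e) S"
    proof (rule member_le_sum)
      show "finite S" using S(1) by (rule finite_subset) simp
      show "0 \<le> b s e i" if "i \<in> S - {s}" for i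
        using that S m e by (auto simp: b_def)
    qed (rule s)
    also have "\<dots> \<le> sum x (out_arcs n S)"
      using demand_le_cut x b s e S by blast
    finally show "1 \<le> sum x (out_arcs n S) + e'" using e by simp
  qed
  moreover have "x \<in> P_AP n"
    using ne b[of _ "1/2"] x by (fastforce simp: P_SCF_iff)
  ultimately show ?thesis by (simp add: P_SCF_bar_def)
qed

text \<open>
  Gale's theorem with supply \<open>1\<close> at node \<open>1\<close> and \<open>-1\<close> at node \<open>k\<close>. A set with positive supply contains
  \<open>1\<close> and misses \<open>k\<close>, so its complement is a nonempty set of nodes other than \<open>1\<close>, and a cut
  inequality or, for a singleton, an assignment equation bounds its capacity.
\<close>

lemma P_SCF_unit_vec_if_P_SCF_bar:
  assumes x: "x \<in> P_SCF_bar n" and k: "k \<in> nodes1 n"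
  shows "x \<in> P_SCF n (unit_vec n k)"
proof -
  have xAP: "x \<in> P_AP n" using x by (simp add: P_SCF_bar_def)
  have k': "k \<in> nodes n" "k \<noteq> 1" "1 \<in> nodes n" using k by (auto simp: nodes1_def nodes_def)
  define d :: "nat \<Rightarrow> real" where "d i = of_bool (i = 1) - of_bool (i = k)" for i
  have sum_d: "sum d S = of_bool (1 \<in> S) - of_bool (k \<in> S)" if "S \<subseteq> nodes n" for S
  proof -
    have "finite S" using that by (rule finite_subset) simp
    then show ?thesis by (simp add: d_def sum_subtractf of_bool_def)
  qed
  have cut: "1 \<le> sum x (out_arcs n T)" if "T \<subseteq> nodes1 n" "T \<noteq> {}" for T
  proof (cases "card T \<ge> 2")
    case True
    then show ?thesis using x that by (simp add: P_SCF_bar_def S1_def)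
  next
    case False
    have "finite T" using that(1) by (rule finite_subset) simp
    then have "card T = 1" using False that(2) card_gt_0_iff[of T] by linarith
    then obtain i where "T = {i}" by (auto simp: card_1_singleton_iff)
    then show ?thesis using P_AP_degree(1)[OF xAP, of i] that by (auto simp: nodes1_def)
  qed
  have nonneg: "0 \<le> x a" if "a \<in> arcs n" for a using P_AP_nonneg[OF xAP that] .
  have "\<exists>f. (\<forall>a\<in>arcs n. 0 \<le> f a \<and> f a \<le> x a) \<and>
    (\<forall>i\<in>nodes n. (\<Sum>a\<in>arcs n. f a * (of_bool (fst a = i) - of_bool (snd a = i))) = d i)"
  proof (rule flow_with_supplies_exists)
    show "sum d (nodes n) = 0" using sum_d[of "nodes n"] k' by simp
    show "sum d S \<le> cut_capacity (arcs n) x S" if S: "S \<subseteq> nodes n" for S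
    proof (cases "1 \<in> S \<and> k \<notin> S")
      case True
      let ?T = "nodes n - S"
      have "1 \<le> sum x (out_arcs n ?T)"
        using True k' by (intro cut) (auto simp: nodes1_def)
      also have "\<dots> = sum x (in_arcs n ?T)" by (rule P_AP_balanced[OF xAP]) simp
      also have "\<dots> = sum x (out_arcs n S)"
        unfolding in_arcs_eq_out_arcs using S by (simp only: double_diff[OF S order_refl])
      finally show ?thesis using True sum_d[OF S] by (simp add: sum_out_arcs)
    next
      case False
      then have "sum d S \<le> 0" using sum_d[OF S] by auto
      also have "0 \<le> cut_capacity (arcs n) x S"
        using nonneg by (auto simp: cut_capacity_def intro!: sum_nonneg)
      finally show ?thesis .
    qed
  qed (use nonneg arcs_subset in auto)
  then obtain f where f: "\<forall>a\<in>arcs n. 0 \<le> f a \<and> f a \<le> x a"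
    and net: "\<forall>i\<in>nodes n. (\<Sum>a\<in>arcs n. f a * (of_bool (fst a = i) - of_bool (snd a = i))) = d i"
    by (elim exE conjE) (rule that)
  have "net_outflow n f {i} = - unit_vec n k i" if "i \<in> nodes1 n" for i
    using net that by (auto simp: net_outflow_eq_sum_arcs nodes1_def unit_vec_def d_def)
  then show ?thesis
    unfolding P_SCF_iff using xAP f by (intro conjI exI[of _ f] ballI) auto
qed

theorem theorem31:
  fixes n :: nat
  assumes "n \<ge> 4"
  shows "(\<Inter>b\<in>B n. P_SCF n b) = (\<Inter>b\<in>V_SCF n. P_SCF n b)
    \<and> (\<Inter>b\<in>V_SCF n. P_SCF n b) = P_SCF_bar n"
proof -
  have "2 \<in> nodes1 n" using assms by (simp add: nodes1_def nodes_def)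
  then have ne: "nodes1 n \<noteq> {}" by blast
  have V: "V_SCF n = unit_vec n ` nodes1 n" by (auto simp: V_SCF_def)
  have "(\<Inter>b\<in>V_SCF n. P_SCF n b) \<subseteq> (\<Inter>b\<in>B n. P_SCF n b)"
    unfolding V
    by (intro subsetI INT_I) (rule P_SCF_if_P_SCF_unit_vec, auto)
  moreover have "(\<Inter>b\<in>B n. P_SCF n b) \<subseteq> P_SCF_bar n"
    by (intro subsetI) (rule P_SCF_bar_if_P_SCF_B[OF ne], auto)
  moreover have "P_SCF_bar n \<subseteq> (\<Inter>b\<in>V_SCF n. P_SCF n b)"
    unfolding V by (auto simp: P_SCF_unit_vec_if_P_SCF_bar)
  ultimately show ?thesis by (metis subset_antisym subset_trans)
qed

end
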